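(* Let $A\in\mathbb{R}^{n\times n}$, $B\in\mathbb{R}^{n\times m}$, $C\in\mathbb{R}^{s\times n}$, $D\in\mathbb{R}^{s\times m}$, $\Sigma=\Sigma(A,B,C,D)$, and let $\mathcal{Y}\subseteq\mathbb{R}^s$ be a convex set with $0\in\mathcal{Y}$ such that $\mathcal{Y}\cap\operatorname{im}\begin{bmatrix}C & D\end{bmatrix}$ has nonempty interior in $\mathbb{R}^s$. Suppose that $\mathcal{K}(\Sigma)\cap\mathcal{Y}=\{0\}$. Then the following statements are equivalent: (i) The system $(\Sigma,\mathcal{Y})$ is reachable. (ii) $X(F)=\mathcal{V}^*(\Sigma)=\mathcal{R}^*(\Sigma)$.
   Context: $\Sigma=\Sigma(A,B,C,D)$ denotes the discrete-time linear system $x_{k+1}=Ax_k+Bu_k$, $y_k=Cx_k+Du_k$ with state in $\mathbb{R}^n$, input in $\mathbb{R}^m$, output in $\mathbb{R}^s$; $(\Sigma,\mathcal{Y})$ is this system with the constraint $y_k\in\mathcal{Y}$. A state $x$ is feasible if there are infinite sequences $\{u_k\}_{k\ge0}$, $\{x_k\}_{k\ge0}$ with $x_0=x$, $x_{k+1}=Ax_k+Bu_k$ and $Cx_k+Du_k\in\mathcal{Y}$ for all $k\ge0$. A state $x$ is reachable if there are $\ell\ge1$, $u_0,\dots,u_{\ell-1}$ and $x_0=0,\dots,x_\ell=x$ with $x_{k+1}=Ax_k+Bu_k$ and $Cx_k+Du_k\in\mathcal{Y}$ for $0\le k\le\ell-1$. $(\Sigma,\mathcal{Y})$ is reachable if every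 feasible state is reachable. The weakly unobservable subspace $\mathcal{V}^*(\Sigma)$ is the set of $x\in\mathbb{R}^n$ for which there are infinite sequences $\{u_k\}_{k\ge0}$, $\{x_k\}_{k\ge0}$ with $x_0=x$, $x_{k+1}=Ax_k+Bu_k$ and $Cx_k+Du_k=0$ for all $k\ge0$. The strongly reachable subspace $\mathcal{T}^*(\Sigma)$ is the set of $x\in\mathbb{R}^n$ for which there are $u_0,\dots,u_{n-1}$ and $x_0=0,x_1,\dots,x_n=x$ with $x_{k+1}=Ax_k+Bu_k$ and $Cx_k+Du_k=0$ for $0\le k\le n-1$. Put $\mathcal{R}^*(\Sigma)=\mathcal{V}^*(\Sigma)\cap\mathcal{T}^*(\Sigma)$ and $\mathcal{K}(\Sigma)=\operatorname{im}D+C\mathcal{T}^*(\Sigma)\subseteq\mathbb{R}^s$. $F:\mathbb{R}^n\rightrightarrows\mathbb{R}^n$ is the set-valued mapping $F(x)=\{Ax+Bu:u\in\mathbb{R}^m,\ Cx+Du\in\mathcal{Y}\}$, and $X(F)$ is the set of $x_0$ from which there is an infinite sequence with $x_{k+1}\in F(x_k)$ for all $k\ge0$. *)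

theory Defs
  imports "HOL-Analysis.Analysis"
begin

text \<open>
  The system x(k+1) = A x(k) + B u(k), y(k) = C x(k) + D u(k), with state space R^n,
  input space R^m and output space R^s. Finite sequences are total functions on nat of which
  only the values at the relevant indices are constrained.
\<close>

definition feasible_state ::
  "real^'n^'n \<Rightarrow> real^'m^'n \<Rightarrow> real^'n^'s \<Rightarrow> real^'m^'s \<Rightarrow> (real^'s) set \<Rightarrow> real^'n \<Rightarrow> bool" where
  "feasible_state A B C D Y \<xi> \<longleftrightarrow>
    (\<exists>(u :: nat \<Rightarrow> real^'m) (x :: nat \<Rightarrow> real^'n). x 0 = \<xi> \<and>
      (\<forall>k. x (Suc k) = A *v x k + B *v u k \<and> C *v x k + D *v u k \<in> Y))"

definition reachable_state ::
  "real^'n^'n \<Rightarrow> real^'m^'n \<Rightarrow> real^'n^'s \<Rightarrow> real^'m^'s \<Rightarrow> (real^'s) set \<Rightarrow> real^'n \<Rightarrow> bool" where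
  "reachable_state A B C D Y \<xi> \<longleftrightarrow>
    (\<exists>l\<ge>1. \<exists>(u :: nat \<Rightarrow> real^'m) (x :: nat \<Rightarrow> real^'n). x 0 = 0 \<and> x l = \<xi> \<and>
      (\<forall>k<l. x (Suc k) = A *v x k + B *v u k \<and> C *v x k + D *v u k \<in> Y))"

definition reachable_system ::
  "real^'n^'n \<Rightarrow> real^'m^'n \<Rightarrow> real^'n^'s \<Rightarrow> real^'m^'s \<Rightarrow> (real^'s) set \<Rightarrow> bool" where
  "reachable_system A B C D Y \<longleftrightarrow>
    (\<forall>\<xi>. feasible_state A B C D Y \<xi> \<longrightarrow> reachable_state A B C D Y \<xi>)"

definition weakly_unobservable_subspace ::
  "real^'n^'n \<Rightarrow> real^'m^'n \<Rightarrow> real^'n^'s \<Rightarrow> real^'m^'s \<Rightarrow> (real^'n) set" where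
  "weakly_unobservable_subspace A B C D =
    {\<xi>. \<exists>(u :: nat \<Rightarrow> real^'m) (x :: nat \<Rightarrow> real^'n). x 0 = \<xi> \<and>
      (\<forall>k. x (Suc k) = A *v x k + B *v u k \<and> C *v x k + D *v u k = 0)}"

definition strongly_reachable_subspace ::
  "real^'n^'n \<Rightarrow> real^'m^'n \<Rightarrow> real^'n^'s \<Rightarrow> real^'m^'s \<Rightarrow> (real^'n) set" where
  "strongly_reachable_subspace A B C D =
    {\<xi>. \<exists>(u :: nat \<Rightarrow> real^'m) (x :: nat \<Rightarrow> real^'n). x 0 = 0 \<and> x CARD('n) = \<xi> \<and>
      (\<forall>k<CARD('n). x (Suc k) = A *v x k + B *v u k \<and> C *v x k + D *v u k = 0)}"

definition R_star ::
  "real^'n^'n \<Rightarrow> real^'m^'n \<Rightarrow> real^'n^'s \<Rightarrow> real^'m^'s \<Rightarrow> (real^'n) set" where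
  "R_star A B C D = weakly_unobservable_subspace A B C D \<inter> strongly_reachable_subspace A B C D"

definition K_subspace ::
  "real^'n^'n \<Rightarrow> real^'m^'n \<Rightarrow> real^'n^'s \<Rightarrow> real^'m^'s \<Rightarrow> (real^'s) set" where
  "K_subspace A B C D =
    {v + w | v w. v \<in> range ((*v) D) \<and> w \<in> (*v) C ` strongly_reachable_subspace A B C D}"

definition system_map ::
  "real^'n^'n \<Rightarrow> real^'m^'n \<Rightarrow> real^'n^'s \<Rightarrow> real^'m^'s \<Rightarrow> (real^'s) set \<Rightarrow> real^'n \<Rightarrow> (real^'n) set" where
  "system_map A B C D Y x = {A *v x + B *v u | u. C *v x + D *v u \<in> Y}"

definition X_feasible :: "('a \<Rightarrow> 'a set) \<Rightarrow> 'a set" where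
  "X_feasible F = {\<xi>. \<exists>x :: nat \<Rightarrow> 'a. x 0 = \<xi> \<and> (\<forall>k. x (Suc k) \<in> F (x k))}"

text \<open>The block matrix [C D]; its columns are indexed by the disjoint sum of the column indices.\<close>

definition block_row :: "real^'n^'s \<Rightarrow> real^'m^'s \<Rightarrow> real^('n + 'm)^'s" where
  "block_row C D = (\<chi> i j. case j of Inl a \<Rightarrow> C $ i $ a | Inr b \<Rightarrow> D $ i $ b)"

end

theory Submission
  imports Defs
begin

text \<open>
  A trajectory that starts in \<open>T*\<close> and has outputs in \<open>Y\<close> keeps its outputs in \<open>K \<inter> Y = {0}\<close>, and
  \<open>T*\<close> is closed under output-nulling steps, so the trajectory stays in \<open>T*\<close>. Hence the
  reachable states of the constrained system are exactly those of \<open>T*\<close>. If every feasible state is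
  reachable, then each state of an infinite feasible trajectory lies in \<open>T*\<close>, so all its outputs
  vanish, and therefore \<open>X(F) \<subseteq> V* \<inter> T*\<close>.
\<close>

text \<open>One step of the classical recursion for \<open>T*\<close>. The l-th iterate from
  \<open>{0}\<close> collects the endpoints of output-nulling trajectories from the origin of length
  exactly l, which turns a question about trajectories into one about a chain of subspaces.\<close>

definition output_nulling_image ::
  "real^'n^'n \<Rightarrow> real^'m^'n \<Rightarrow> real^'n^'s \<Rightarrow> real^'m^'s \<Rightarrow> (real^'n) set \<Rightarrow> (real^'n) set" where
  "output_nulling_image A B C D S =
    {A *v x + B *v u | x u. x \<in> S \<and> C *v x + D *v u = 0}"

lemma output_nulling_imageI:
  "x \<in> S \<Longrightarrow> C *v x + D *v u = 0 \<Longrightarrow> A *v x + B *v u \<in> output_nulling_image A B C D S"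
  unfolding output_nulling_image_def by blast

lemma output_nulling_image_mono:
  "S \<subseteq> S' \<Longrightarrow> output_nulling_image A B C D S \<subseteq> output_nulling_image A B C D S'"
  unfolding output_nulling_image_def by blast

lemma subspace_output_nulling_image:
  assumes "subspace S"
  shows "subspace (output_nulling_image A B C D S)"
proof (rule subspaceI)
  show "0 \<in> output_nulling_image A B C D S"
    using output_nulling_imageI[of 0 S C D 0 A B] subspace_0[OF assms] by simp
next
  fix p q
  assume "p \<in> output_nulling_image A B C D S" "q \<in> output_nulling_image A B C D S"
  then obtain x u y v where "x \<in> S" "y \<in> S"
      and null: "C *v x + D *v u = 0" "C *v y + D *v v = 0"
      and pq: "p = A *v x + B *v u" "q = A *v y + B *v v"
    unfolding output_nulling_image_def by blast
  have "C *v (x + y) + D *v (u + v) = (C *v x + D *v u) + (C *v y + D *v v)"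
    by (simp add: matrix_vector_right_distrib algebra_simps)
  then have "C *v (x + y) + D *v (u + v) = 0"
    using null by simp
  then have "A *v (x + y) + B *v (u + v) \<in> output_nulling_image A B C D S"
    using \<open>x \<in> S\<close> \<open>y \<in> S\<close> assms by (intro output_nulling_imageI subspace_add)
  then show "p + q \<in> output_nulling_image A B C D S"
    unfolding pq by (simp add: matrix_vector_right_distrib algebra_simps)
next
  fix c p
  assume "p \<in> output_nulling_image A B C D S"
  then obtain x u where "x \<in> S" and null: "C *v x + D *v u = 0" and p: "p = A *v x + B *v u"
    unfolding output_nulling_image_def by blast
  have "C *v (c *\<^sub>R x) + D *v (c *\<^sub>R u) = c *\<^sub>R (C *v x + D *v u)"
    by (simp add: matrix_vector_mult_scaleR scaleR_add_right)
  then have "C *v (c *\<^sub>R x) + D *v (c *\<^sub>R u) = 0"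
    using null by simp
  then have "A *v (c *\<^sub>R x) + B *v (c *\<^sub>R u) \<in> output_nulling_image A B C D S"
    using \<open>x \<in> S\<close> assms by (intro output_nulling_imageI subspace_scale)
  then show "c *\<^sub>R p \<in> output_nulling_image A B C D S"
    unfolding p by (simp add: matrix_vector_mult_scaleR scaleR_add_right)
qed

text \<open>The iterates from \<open>{0}\<close> form an increasing chain of subspaces, so each
  strict inclusion raises the dimension by at least one. At most \<open>DIM('a)\<close> strict
  inclusions fit, and once two consecutive terms agree the chain is constant.\<close>

lemma funpow_subspace_chain_stabilizes:
  fixes f :: "'a::euclidean_space set \<Rightarrow> 'a set"
  assumes mono: "\<And>S S'. S \<subseteq> S' \<Longrightarrow> f S \<subseteq> f S'"
    and subspace: "\<And>S. subspace S \<Longrightarrow> subspace (f S)"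
  shows "f ((f ^^ DIM('a)) {0}) = (f ^^ DIM('a)) {0}"
proof -
  let ?T = "\<lambda>k. (f ^^ k) {0}"
  have sub: "subspace (?T k)" for k
    by (induction k) (auto simp: subspace subspace_0)
  have incr: "?T k \<subseteq> ?T (Suc k)" for k
  proof (induction k)
    case 0
    show ?case using subspace_0[OF sub[of 1]] by simp
  next
    case (Suc k)
    then show ?case using mono by simp
  qed
  \<comment> \<open>Either every inclusion so far was strict, so the dimension has kept up with the
    index, or the chain has stopped. An equality found at one index passes to the next by applying
    \<open>f\<close> to both sides.\<close>
  have "k \<le> dim (?T k) \<or> ?T (Suc k) = ?T k" for k
  proof (induction k)
    case (Suc k)
    show ?case
    proof (cases "?T (Suc k) = ?T k")
      case False
      then have "dim (?T k) \<noteq> dim (?T (Suc k))"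
        using subspace_dim_equal[OF sub sub incr] by (metis order_refl)
      moreover have "dim (?T k) \<le> dim (?T (Suc k))"
        by (rule dim_subset[OF incr])
      ultimately show ?thesis using Suc False by simp
    qed simp
  qed simp
  then consider "DIM('a) \<le> dim (?T DIM('a))" | "?T (Suc DIM('a)) = ?T DIM('a)"
    by blast
  then show ?thesis
  proof cases
    case 1
    \<comment> \<open>If the chain never stopped early, it has filled the whole space and cannot
      grow further.\<close>
    then have "?T DIM('a) = UNIV"
      by (intro subspace_dim_equal) (auto simp: sub)
    then show ?thesis using incr[of "DIM('a)"] by auto
  qed simp
qed

lemma mem_funpow_output_nulling_image_iff:
  "\<xi> \<in> (output_nulling_image A B C D ^^ l) {0} \<longleftrightarrow>
    (\<exists>u x. x 0 = 0 \<and> x l = \<xi> \<and>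
      (\<forall>k<l. x (Suc k) = A *v x k + B *v u k \<and> C *v x k + D *v u k = 0))"
proof (induction l arbitrary: \<xi>)
  case 0
  show ?case by auto
next
  case (Suc l)
  show ?case
  proof
    assume "\<xi> \<in> (output_nulling_image A B C D ^^ Suc l) {0}"
    then obtain z v where "z \<in> (output_nulling_image A B C D ^^ l) {0}"
        and zv: "C *v z + D *v v = 0" "\<xi> = A *v z + B *v v"
      by (auto simp: output_nulling_image_def)
    then obtain u x where "x 0 = 0" "x l = z"
        "\<forall>k<l. x (Suc k) = A *v x k + B *v u k \<and> C *v x k + D *v u k = 0"
      using Suc by blast
    with zv show "\<exists>u x. x 0 = 0 \<and> x (Suc l) = \<xi> \<and>
      (\<forall>k<Suc l. x (Suc k) = A *v x k + B *v u k \<and> C *v x k + D *v u k = 0)"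
      \<comment> \<open>The trajectory is prolonged by one step; the updates at \<open>l\<close> and
        \<open>Suc l\<close> leave the first \<open>l\<close> transitions untouched.\<close>
      by (intro exI[of _ "u(l := v)"] exI[of _ "x(Suc l := \<xi>)"]) (auto simp: less_Suc_eq)
  next
    assume "\<exists>u x. x 0 = 0 \<and> x (Suc l) = \<xi> \<and>
      (\<forall>k<Suc l. x (Suc k) = A *v x k + B *v u k \<and> C *v x k + D *v u k = 0)"
    then obtain u x where traj: "x 0 = 0" "x (Suc l) = \<xi>"
        "\<forall>k<Suc l. x (Suc k) = A *v x k + B *v u k \<and> C *v x k + D *v u k = 0"
      by blast
    then have "x l \<in> (output_nulling_image A B C D ^^ l) {0}"
      unfolding Suc by (intro exI[of _ u] exI[of _ x]) simp
    then show "\<xi> \<in> (output_nulling_image A B C D ^^ Suc l) {0}"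
      using traj output_nulling_imageI[of "x l" _ C D "u l" A B] by auto
  qed
qed

lemma strongly_reachable_subspace_eq_funpow:
  fixes A :: "real^'n^'n"
  shows "strongly_reachable_subspace A B C D = (output_nulling_image A B C D ^^ CARD('n)) {0}"
  unfolding strongly_reachable_subspace_def set_eq_iff mem_funpow_output_nulling_image_iff by simp

lemma zero_in_strongly_reachable_subspace: "0 \<in> strongly_reachable_subspace A B C D"
  unfolding strongly_reachable_subspace_def
  by (auto intro!: exI[of _ "\<lambda>_. 0"])

text \<open>Appending a step to an output-nulling trajectory of length n gives one of length n + 1,
  whereas \<open>T*\<close> asks for length exactly n. Since n is the dimension of the state space,
  the chain is already stationary there and the two lengths reach the same states.\<close>

lemma strongly_reachable_subspace_step:
  fixes A :: "real^'n^'n"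
  assumes "x \<in> strongly_reachable_subspace A B C D" "C *v x + D *v u = 0"
  shows "A *v x + B *v u \<in> strongly_reachable_subspace A B C D"
proof -
  have "output_nulling_image A B C D (strongly_reachable_subspace A B C D)
      = strongly_reachable_subspace A B C D"
    using funpow_subspace_chain_stabilizes
      [OF output_nulling_image_mono[of _ _ A B C D] subspace_output_nulling_image[of _ A B C D]]
    by (simp add: strongly_reachable_subspace_eq_funpow)
  then show ?thesis
    using output_nulling_imageI[OF assms] by blast
qed

lemma output_in_K_subspace:
  assumes "x \<in> strongly_reachable_subspace A B C D"
  shows "C *v x + D *v u \<in> K_subspace A B C D"
  using assms unfolding K_subspace_def
  by (intro CollectI exI[of _ "D *v u"] exI[of _ "C *v x"]) (simp add: add.commute)

lemma reachable_state_iff_strongly_reachable: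
  fixes A :: "real^'n^'n"
  assumes "K_subspace A B C D \<inter> Y = {0}"
  shows "reachable_state A B C D Y \<xi> \<longleftrightarrow> \<xi> \<in> strongly_reachable_subspace A B C D"
proof
  assume "reachable_state A B C D Y \<xi>"
  then obtain l u x where "x 0 = 0" "x l = \<xi>"
      and step: "\<And>k. k < l \<Longrightarrow> x (Suc k) = A *v x k + B *v u k \<and> C *v x k + D *v u k \<in> Y"
    unfolding reachable_state_def by blast
  have "x k \<in> strongly_reachable_subspace A B C D" if "k \<le> l" for k
    using that
  proof (induction k)
    case 0
    show ?case using \<open>x 0 = 0\<close> zero_in_strongly_reachable_subspace by simp
  next
    case (Suc k)
    then have mem: "x k \<in> strongly_reachable_subspace A B C D" and "k < l"
      by auto
    then have "C *v x k + D *v u k = 0"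
      using step output_in_K_subspace assms by blast
    then show ?case
      using strongly_reachable_subspace_step[OF mem] step[OF \<open>k < l\<close>] by simp
  qed
  then show "\<xi> \<in> strongly_reachable_subspace A B C D"
    using \<open>x l = \<xi>\<close> by blast
next
  assume "\<xi> \<in> strongly_reachable_subspace A B C D"
  then obtain u x where "x 0 = 0" "x CARD('n) = \<xi>"
      "\<forall>k<CARD('n). x (Suc k) = A *v x k + B *v u k \<and> C *v x k + D *v u k = 0"
    unfolding strongly_reachable_subspace_def by blast
  \<comment> \<open>The n-step output-nulling trajectory itself witnesses reachability: zero outputs
    are admissible, and \<open>l = CARD('n)\<close> meets the requirement
    \<open>l \<ge> 1\<close>.\<close>
  moreover have "0 \<in> Y" "CARD('n) \<ge> 1"
    using assms by (auto simp: Suc_le_eq)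
  ultimately show "reachable_state A B C D Y \<xi>"
    unfolding reachable_state_def by metis
qed

lemma X_feasible_system_map: "X_feasible (system_map A B C D Y) = {\<xi>. feasible_state A B C D Y \<xi>}"
proof -
  have "(\<forall>k. x (Suc k) \<in> system_map A B C D Y (x k)) \<longleftrightarrow>
      (\<exists>u. \<forall>k. x (Suc k) = A *v x k + B *v u k \<and> C *v x k + D *v u k \<in> Y)" for x
    \<comment> \<open>Membership in the set-valued map provides an input for each time separately;
      choice assembles these into one input sequence.\<close>
    unfolding system_map_def by (subst choice_iff[symmetric]) blast
  then show ?thesis
    unfolding X_feasible_def feasible_state_def by blast
qed

text \<open>Time invariance: the tail of an admissible trajectory is admissible. This lets
  reachability of feasible states be applied at every time and not only to the initial
  state.\<close>

lemma feasible_state_trajectory: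
  assumes "\<And>k. x (Suc k) = A *v x k + B *v u k \<and> C *v x k + D *v u k \<in> Y"
  shows "feasible_state A B C D Y (x k)"
  unfolding feasible_state_def
  using assms by (intro exI[of _ "\<lambda>i. u (i + k)"] exI[of _ "\<lambda>i. x (i + k)"]) simp

text \<open>With \<open>V*\<close> read as feasibility for the constraint set \<open>{0}\<close>,
  comparing it with \<open>X(F)\<close> amounts to comparing the constraints \<open>{0}\<close> and
  \<open>Y\<close>.\<close>

lemma weakly_unobservable_subspace_eq:
  "weakly_unobservable_subspace A B C D = {\<xi>. feasible_state A B C D {0} \<xi>}"
  unfolding weakly_unobservable_subspace_def feasible_state_def by simp

theorem theorem4p14:
  fixes A :: "real^'n^'n" and B :: "real^'m^'n" and C :: "real^'n^'s" and D :: "real^'m^'s"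
    and Y :: "(real^'s) set"
  assumes "convex Y"
    and "0 \<in> Y"
    and "interior (Y \<inter> range ((*v) (block_row C D))) \<noteq> {}"
    and "K_subspace A B C D \<inter> Y = {0}"
  shows "reachable_system A B C D Y \<longleftrightarrow>
    X_feasible (system_map A B C D Y) = weakly_unobservable_subspace A B C D \<and>
    weakly_unobservable_subspace A B C D = R_star A B C D"
proof
  assume "reachable_system A B C D Y"
  then have strong: "\<xi> \<in> strongly_reachable_subspace A B C D" if "feasible_state A B C D Y \<xi>" for \<xi>
    using that reachable_state_iff_strongly_reachable[OF assms(4)]
    unfolding reachable_system_def by blast
  have "feasible_state A B C D {0} \<xi>" if "feasible_state A B C D Y \<xi>" for \<xi>
  proof -
    from that obtain u x where "x 0 = \<xi>"
        and step: "\<And>k. x (Suc k) = A *v x k + B *v u k \<and> C *v x k + D *v u k \<in> Y"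
      unfolding feasible_state_def by blast
    have "C *v x k + D *v u k = 0" for k
    proof -
      have "feasible_state A B C D Y (x k)"
        using step by (rule feasible_state_trajectory)
      then show ?thesis
        using output_in_K_subspace[OF strong] step assms(4) by blast
    qed
    then show ?thesis
      unfolding feasible_state_def using \<open>x 0 = \<xi>\<close> step by blast
  qed
  moreover have "feasible_state A B C D Y \<xi>" if "feasible_state A B C D {0} \<xi>" for \<xi>
    using that \<open>0 \<in> Y\<close> unfolding feasible_state_def by (metis singletonD)
  \<comment> \<open>Feasibility for \<open>Y\<close> and for \<open>{0}\<close> now coincide, so
    \<open>X(F) = V*\<close>; as feasible states lie in \<open>T*\<close>, also
    \<open>V* = V* \<inter> T*\<close>.\<close>
  ultimately show "X_feasible (system_map A B C D Y) = weakly_unobservable_subspace A B C D \<and>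
      weakly_unobservable_subspace A B C D = R_star A B C D"
    using strong unfolding X_feasible_system_map weakly_unobservable_subspace_eq R_star_def by blast
next
  assume "X_feasible (system_map A B C D Y) = weakly_unobservable_subspace A B C D \<and>
    weakly_unobservable_subspace A B C D = R_star A B C D"
  \<comment> \<open>A feasible state lies in \<open>X(F) = R*\<close>, hence in \<open>T*\<close>,
    whose elements are exactly the reachable states.\<close>
  then show "reachable_system A B C D Y"
    unfolding reachable_system_def reachable_state_iff_strongly_reachable[OF assms(4)]
      X_feasible_system_map R_star_def by blast
qed

end
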